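(* Let $n,k,d,q$ be nonnegative integers with $q\ge d$. The generalized Stirling number $\left\{{n\atop k}\right\}_{q,d}$ is the number of partial bijections $g$ from $[n]\times[d]$ to $[n]\times[q]$ with the property $$\forall (i,a,j,b)\in[n]\times[d]\times[n]\times[q],\qquad g(i,a)=(j,b)\ \Rightarrow\ j<i,$$ and such that $\#\operatorname{Dom}(g)=nd-k$.
   Context: $[n]=\{1,\ldots,n\}$, $[0]=\emptyset$; $\#$ denotes cardinality. A partial bijection from a set $X$ to a set $Y$ is a bijection $g$ from some subset $\operatorname{Dom}(g)$ of $X$ to some subset of $Y$. Generalized Stirling numbers: let $\partial_x=\frac{d}{dx}$ act on $\mathbb{Z}[x]$, and let $x$ act by multiplication. For $q\ge d$, the numbers $\left\{{n\atop k}\right\}_{q,d}$ are the coefficients determined by the operator identity $$(x^q\partial_x^d)^n=x^{(q-d)n}\sum_k\left\{{n\atop k}\right\}_{q,d}x^k\partial_x^k .$$ *)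

theory Defs
  imports "HOL-Computational_Algebra.Polynomial" "HOL-Library.Groups_Big_Fun"
begin

definition x_power_deriv :: "nat \<Rightarrow> nat \<Rightarrow> int poly \<Rightarrow> int poly" where
  "x_power_deriv q d p = monom 1 q * (pderiv ^^ d) p"

(* Operators are compared by their action on each polynomial p. As the k-th derivative of p
   vanishes for k > degree p, the sum over all k has only finitely many nonzero terms,
   so Sum_any is the actual sum, whatever the coefficients c are. *)
definition normal_ordering_coeffs :: "nat \<Rightarrow> nat \<Rightarrow> nat \<Rightarrow> (nat \<Rightarrow> int) \<Rightarrow> bool" where
  "normal_ordering_coeffs q d n c \<longleftrightarrow>
     (\<forall>p. (x_power_deriv q d ^^ n) p =
        monom 1 ((q - d) * n) * Sum_any (\<lambda>k. smult (c k) (x_power_deriv k k p)))"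

(* Only meaningful for d \<le> q: the subtraction q - d above is the truncated one on nat. *)
definition gen_stirling :: "nat \<Rightarrow> nat \<Rightarrow> nat \<Rightarrow> nat \<Rightarrow> int" where
  "gen_stirling q d n = (THE c. normal_ordering_coeffs q d n c)"

(* Partial functions are maps; g x = None exactly for x outside Dom(g). *)
definition partial_bijections :: "'a set \<Rightarrow> 'b set \<Rightarrow> ('a \<rightharpoonup> 'b) set" where
  "partial_bijections X Y =
     {g. dom g \<subseteq> X \<and> ran g \<subseteq> Y \<and> bij_betw (\<lambda>x. the (g x)) (dom g) (ran g)}"

end

theory Submission
  imports Defs
begin

text \<open>
  The theorem is the combinatorial form of normal ordering (Wick's theorem). Read
  \<open>(x\<^sup>q \<partial>\<^sup>d)\<^sup>n\<close> from right to left as a word of single derivatives and powers of \<open>x\<close>.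
  When \<open>\<partial>\<close> is multiplied from the left onto a normally ordered term \<open>x\<^sup>e \<partial>\<^sup>m\<close>, the product rule
  \<open>\<partial> x\<^sup>e \<partial>\<^sup>m = x\<^sup>e \<partial>\<^sup>m\<^sup>+\<^sup>1 + e x\<^sup>e\<^sup>-\<^sup>1 \<partial>\<^sup>m\<close> says that this \<open>\<partial>\<close> either moves past all remaining letters \<open>x\<close>
  or is contracted with exactly one of the \<open>e\<close> letters that are still present. Numbering the \<open>n\<close>
  factors from right to left, the \<open>a\<close>-th derivative of factor \<open>i\<close> is a source \<open>(i, a)\<close>, the
  \<open>b\<close>-th letter \<open>x\<close> of factor \<open>j\<close> is a target \<open>(j, b)\<close>, and a contraction is possible only if the
  letter stands to the right of the derivative, that is, if \<open>j < i\<close>. A complete record of the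
  contractions is therefore one of the partial bijections \<open>g\<close> to be counted, and it contributes
  \<open>x\<^bsup>nq - r\<^esup> \<partial>\<^bsup>nd - r\<^esup>\<close> with \<open>r = #Dom(g)\<close>. For \<open>k = nd - r\<close> this is
  \<open>x\<^bsup>(q - d)n\<^esup> x\<^sup>k \<partial>\<^sup>k\<close>, so the coefficient at \<open>k\<close> is the number of \<open>g\<close> with \<open>nd - k\<close> sources.

  Lemma \<open>pderiv_contraction_sum\<close> is the product-rule step, \<open>x_power_deriv_iterate\<close> the resulting
  expansion of the operator, and \<open>normal_ordering_coeffs_unique\<close> shows that the operator
  determines its coefficients.
\<close>

section \<open>Uniqueness of normally ordered expansions\<close>

lemma x_power_deriv_eq_0: "degree p < k \<Longrightarrow> x_power_deriv k k p = 0"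
proof -
  assume "degree p < k"
  then have "(pderiv ^^ k) p = 0"
  proof (induction k arbitrary: p)
    case (Suc k)
    show ?case
    proof (cases "pderiv p = 0")
      case True
      have "(pderiv ^^ k) (0 :: int poly) = 0"
        by (induction k) auto
      with True show ?thesis by (simp add: funpow_Suc_right del: funpow.simps)
    next
      case False
      then have "degree (pderiv p) < k"
        using Suc.prems degree_pderiv[of p] by (cases "degree p = 0") (auto simp: pderiv_eq_0_iff)
      then show ?thesis using Suc.IH by (simp add: funpow_Suc_right del: funpow.simps)
    qed
  qed simp
  then show ?thesis by (simp add: x_power_deriv_def)
qed

lemma x_power_deriv_monom: "x_power_deriv k k (monom 1 k) = monom (fact k) k"
proof -
  have "(pderiv ^^ k) (monom c k) = monom (c * fact k) 0" for c :: int
  proof (induction k arbitrary: c)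
    case (Suc k)
    have "(pderiv ^^ Suc k) (monom c (Suc k)) = (pderiv ^^ k) (monom (of_nat (Suc k) * c) k)"
      by (simp add: funpow_Suc_right pderiv_monom del: funpow.simps)
    then show ?case by (simp add: Suc.IH algebra_simps)
  qed simp
  from this[of 1] show ?thesis by (simp add: x_power_deriv_def mult_monom)
qed

lemma Sum_any_x_power_deriv:
  "Sum_any (\<lambda>k. smult (c k) (x_power_deriv k k p)) =
    (\<Sum>k\<le>degree p. smult (c k) (x_power_deriv k k p))"
  by (rule Sum_any.expand_superset) (auto intro: ccontr simp: x_power_deriv_eq_0 not_le[symmetric])

text \<open>
  The system is triangular: on \<open>x\<^sup>N\<close> only the terms with \<open>k \<le> N\<close> survive, and the one
  with \<open>k = N\<close> is \<open>N!\<close> times its coefficient.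
\<close>

lemma normal_ordering_coeffs_unique:
  assumes "normal_ordering_coeffs q d n c" "normal_ordering_coeffs q d n c'"
  shows "c = c'"
proof
  fix N
  show "c N = c' N"
  proof (induction N rule: less_induct)
    case (less N)
    let ?t = "\<lambda>c k. smult (c k :: int) (x_power_deriv k k (monom 1 N))"
    have "monom 1 ((q - d) * n) * Sum_any (?t c) = monom 1 ((q - d) * n) * Sum_any (?t c')"
      using assms unfolding normal_ordering_coeffs_def by metis
    then have "Sum_any (?t c) = Sum_any (?t c')"
      by (simp add: monom_eq_0_iff)
    then have "(\<Sum>k\<le>N. ?t c k) = (\<Sum>k\<le>N. ?t c' k)"
      by (simp only: Sum_any_x_power_deriv degree_monom_eq one_neq_zero not_False_eq_True)
    moreover have "(\<Sum>k<N. ?t c k) = (\<Sum>k<N. ?t c' k)"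
      using less by (intro sum.cong) auto
    ultimately have "?t c N = ?t c' N"
      by (simp flip: lessThan_Suc_atMost)
    then show ?case
      by (simp add: x_power_deriv_monom smult_monom)
  qed
qed

section \<open>Matchings compatible with a relation\<close>

definition matchings :: "('a \<Rightarrow> 'b \<Rightarrow> bool) \<Rightarrow> 'a set \<Rightarrow> ('a \<rightharpoonup> 'b) set" where
  "matchings R X = {g. dom g \<subseteq> X \<and> inj_on g (dom g) \<and> (\<forall>s t. g s = Some t \<longrightarrow> R s t)}"

lemma matchings_empty: "matchings R {} = {Map.empty}"
  by (auto simp: matchings_def)

lemma matchings_insert:
  assumes "s \<notin> X"
  shows "matchings R (insert s X) = matchings R X \<union>
    (\<lambda>(g, t). g(s \<mapsto> t)) ` (SIGMA g:matchings R X. {t. R s t} - ran g)"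
    (is "?L = _ \<union> ?f ` ?E")
proof (intro equalityI subsetI)
  fix h assume h: "h \<in> ?L"
  show "h \<in> matchings R X \<union> ?f ` ?E"
  proof (cases "h s")
    case None
    then have "dom h \<subseteq> X" using h by (auto simp: matchings_def)
    then show ?thesis using h by (simp add: matchings_def)
  next
    case (Some t)
    let ?g = "h(s := None)"
    have "t \<notin> ran ?g"
      using h Some by (auto simp: matchings_def ran_def inj_on_def domIff split: if_splits)
    moreover have "?g \<in> matchings R X"
      using h by (auto simp: matchings_def inj_on_def split: if_splits)
    ultimately have "(?g, t) \<in> ?E"
      using h Some by (auto simp: matchings_def)
    moreover have "h = ?f (?g, t)"
      using Some by auto
    ultimately show ?thesis by blast
  qed
next
  fix h assume "h \<in> matchings R X \<union> ?f ` ?E"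
  then consider "h \<in> matchings R X"
    | g t where "g \<in> matchings R X" "R s t" "t \<notin> ran g" "h = g(s \<mapsto> t)"
    by auto
  then show "h \<in> ?L"
  proof cases
    case 1
    then show ?thesis by (auto simp: matchings_def)
  next
    case 2
    then show ?thesis
      by (auto simp: matchings_def inj_on_def ran_def)
  qed
qed

lemma finite_matchings:
  assumes "finite X" "\<And>s. s \<in> X \<Longrightarrow> finite {t. R s t}"
  shows "finite (matchings R X)"
  using assms
  by (induction X rule: finite_induct) (simp_all add: matchings_empty matchings_insert)

lemma card_ran_matching:
  assumes "g \<in> matchings R X"
  shows "card (ran g) = card (dom g)"
proof -
  have "Some ` ran g = g ` dom g"
    by (force simp: ran_def)
  then have "card (Some ` ran g) = card (dom g)"
    using assms by (simp add: matchings_def card_image)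
  then show ?thesis by (simp add: card_image)
qed

lemma card_dom_matching_le:
  assumes "g \<in> matchings R X" "finite T" "\<And>s t. s \<in> X \<Longrightarrow> R s t \<Longrightarrow> t \<in> T"
  shows "card (dom g) \<le> card T"
proof -
  have "ran g \<subseteq> T"
    using assms(1,3) unfolding matchings_def ran_def by blast
  then show ?thesis
    using card_mono[OF assms(2)] by (simp flip: card_ran_matching[OF assms(1)])
qed

section \<open>Expansion of the operator into contractions\<close>

text \<open>
  The normally ordered form, applied to \<open>p\<close>, of a word with derivatives \<open>X\<close> and \<open>e\<close> letters \<open>x\<close>.
\<close>

definition contraction_sum ::
    "('a \<Rightarrow> 'b \<Rightarrow> bool) \<Rightarrow> nat \<Rightarrow> 'a set \<Rightarrow> int poly \<Rightarrow> int poly" where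
  "contraction_sum R e X p =
    (\<Sum>g\<in>matchings R X. monom 1 (e - card (dom g)) * (pderiv ^^ (card X - card (dom g))) p)"

text \<open>
  The new derivative \<open>s\<close> stands to the left of all letters, so every letter is an admissible target
  of it, and those already contracted form the range of \<open>g\<close>. In the product rule, the derivative
  of \<open>p\<close> accounts for \<open>s\<close> staying unmatched, and the factor \<open>e - #Dom(g)\<close> from
  differentiating the power of \<open>x\<close> counts the free targets of \<open>s\<close>.
\<close>

lemma pderiv_contraction_sum:
  assumes X: "finite X" "s \<notin> X" and fin: "finite {t. R s t}"
    and mono: "\<And>s' t. s' \<in> X \<Longrightarrow> R s' t \<Longrightarrow> R s t"
  shows "pderiv (contraction_sum R (card {t. R s t}) X p) =
    contraction_sum R (card {t. R s t}) (insert s X) p"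
proof -
  let ?T = "{t. R s t}" and ?M = "matchings R X" and ?f = "\<lambda>(g, t). g(s \<mapsto> t)"
  let ?E = "SIGMA g:?M. ?T - ran g"
  define w where "w Y g = monom 1 (card ?T - card (dom g)) * (pderiv ^^ (card Y - card (dom g))) p"
    for Y :: "'a set" and g :: "'a \<rightharpoonup> 'b"
  have fin_X: "finite {t. R s' t}" if "s' \<in> X" for s'
    by (rule finite_subset[OF _ fin]) (use mono that in auto)
  have finM: "finite ?M"
    by (rule finite_matchings[OF X(1) fin_X])
  have dom: "dom g \<subseteq> X" "finite (dom g)" "card (dom g) \<le> card X" "s \<notin> dom g" if "g \<in> ?M" for g
    using that X by (auto simp: matchings_def intro: finite_subset card_mono)
  have none: "g s = None" if "g \<in> ?M" for g
    using dom(4)[OF that] by auto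
  have free: "card (?T - ran g) = card ?T - card (dom g)" if "g \<in> ?M" for g
  proof -
    have "ran g \<subseteq> ?T"
      using that mono unfolding matchings_def ran_def by blast
    then show ?thesis
      using card_Diff_subset[OF finite_subset[OF _ fin]] card_ran_matching[OF that] by simp
  qed
  have inj: "inj_on ?f ?E"
  proof (rule inj_onI, clarify)
    fix g t h u
    assume *: "g \<in> ?M" "h \<in> ?M" "g(s \<mapsto> t) = h(s \<mapsto> u)"
    have "g = (g(s \<mapsto> t))(s := None)" "h = (h(s \<mapsto> u))(s := None)"
      using none *(1,2) by auto
    moreover have "t = u" using fun_cong[OF *(3), of s] by simp
    ultimately show "g = h \<and> t = u" using *(3) by metis
  qed
  have disj: "?M \<inter> ?f ` ?E = {}"
    using none by (fastforce simp: fun_upd_def)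
  have unmatched: "w (insert s X) g =
      monom 1 (card ?T - card (dom g)) * pderiv ((pderiv ^^ (card X - card (dom g))) p)"
    if "g \<in> ?M" for g
    using X dom(3)[OF that] by (simp add: w_def Suc_diff_le)
  have matched: "(\<Sum>t\<in>?T - ran g. w (insert s X) (g(s \<mapsto> t))) =
      pderiv (monom 1 (card ?T - card (dom g))) * (pderiv ^^ (card X - card (dom g))) p"
    if "g \<in> ?M" for g
  proof -
    have "w (insert s X) (g(s \<mapsto> t)) =
        monom 1 (card ?T - card (dom g) - 1) * (pderiv ^^ (card X - card (dom g))) p" for t
      using X dom[OF that] by (simp add: w_def)
    then show ?thesis
      by (simp add: free[OF that] pderiv_monom of_nat_monom mult_monom flip: mult.assoc)
  qed
  have "contraction_sum R (card ?T) (insert s X) p =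
      (\<Sum>g\<in>?M. w (insert s X) g) + (\<Sum>g\<in>?f ` ?E. w (insert s X) g)"
    unfolding contraction_sum_def matchings_insert[OF X(2)] w_def
    by (rule sum.union_disjoint) (use finM fin disj in auto)
  also have "(\<Sum>g\<in>?f ` ?E. w (insert s X) g) =
      (\<Sum>g\<in>?M. \<Sum>t\<in>?T - ran g. w (insert s X) (g(s \<mapsto> t)))"
    by (subst sum.reindex[OF inj], subst sum.Sigma)
       (use finM fin in \<open>auto simp: case_prod_unfold\<close>)
  also have "(\<Sum>g\<in>?M. w (insert s X) g) + \<dots> = (\<Sum>g\<in>?M. pderiv (w X g))"
    unfolding sum.distrib[symmetric]
    by (rule sum.cong) (simp_all add: unmatched matched, simp add: w_def pderiv_mult algebra_simps)
  also have "\<dots> = pderiv (contraction_sum R (card ?T) X p)"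
    by (simp add: contraction_sum_def w_def higher_pderiv_sum[of 1, simplified])
  finally show ?thesis ..
qed

text \<open>
  Letters added on the left are out of reach of the derivatives in \<open>X\<close>, so the matchings do not
  change. The bound makes the exponent \<open>e - #Dom(g)\<close> a true difference: without it the truncated
  subtraction would not commute with adding \<open>r\<close>.
\<close>

lemma monom_mult_contraction_sum:
  assumes "\<And>g. g \<in> matchings R X \<Longrightarrow> card (dom g) \<le> e"
  shows "monom 1 r * contraction_sum R e X p = contraction_sum R (e + r) X p"
  unfolding contraction_sum_def sum_distrib_left
  by (rule sum.cong) (simp_all add: assms mult_monom add.commute flip: mult.assoc)

text \<open>
  The bounds on \<open>j\<close> and \<open>b\<close> make the targets of a source exactly the letters to its right, so that
  \<open>pderiv_contraction_sum\<close> applies with \<open>e\<close> equal to their number.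
\<close>

definition to_the_right :: "nat \<Rightarrow> nat \<times> nat \<Rightarrow> nat \<times> nat \<Rightarrow> bool" where
  "to_the_right q = (\<lambda>(i, a) (j, b). j \<in> {1..<i} \<and> b \<in> {1..q})"

lemma targets_of_Suc: "{t. to_the_right q (Suc n, a) t} = {1..n} \<times> {1..q}"
  by (auto simp: to_the_right_def)

text \<open>
  The derivatives of factor \<open>n + 1\<close> are attached before its letters \<open>x\<close>, so all of them
  see the same \<open>nq\<close> letters of the first \<open>n\<close> factors.
\<close>

lemma pderiv_power_contraction_sum:
  "(pderiv ^^ m) (contraction_sum (to_the_right q) (n * q) ({1..n} \<times> {1..d}) p) =
    contraction_sum (to_the_right q) (n * q) ({1..n} \<times> {1..d} \<union> {Suc n} \<times> {1..m}) p"
proof (induction m)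
  case (Suc m)
  let ?X = "{1..n} \<times> {1..d} \<union> {Suc n} \<times> {1..m}" and ?s = "(Suc n, Suc m)"
  have "pderiv (contraction_sum (to_the_right q) (card {t. to_the_right q ?s t}) ?X p) =
      contraction_sum (to_the_right q) (card {t. to_the_right q ?s t}) (insert ?s ?X) p"
    by (rule pderiv_contraction_sum) (auto simp: targets_of_Suc, auto simp: to_the_right_def)
  moreover have "insert ?s ?X = {1..n} \<times> {1..d} \<union> {Suc n} \<times> {1..Suc m}"
    by auto
  ultimately show ?case
    using Suc by (simp add: targets_of_Suc)
qed simp

lemma x_power_deriv_iterate:
  "(x_power_deriv q d ^^ n) p = contraction_sum (to_the_right q) (n * q) ({1..n} \<times> {1..d}) p"
proof (induction n)
  case 0
  show ?case by (simp add: contraction_sum_def matchings_empty)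
next
  case (Suc n)
  let ?X = "{1..n} \<times> {1..d} \<union> {Suc n} \<times> {1..d}"
  have "card (dom g) \<le> n * q" if "g \<in> matchings (to_the_right q) ?X" for g
  proof -
    have "card (dom g) \<le> card ({1..n} \<times> {1..q})"
      by (rule card_dom_matching_le[OF that]) (auto simp: to_the_right_def)
    then show ?thesis by simp
  qed
  then have "(x_power_deriv q d ^^ Suc n) p = contraction_sum (to_the_right q) (n * q + q) ?X p"
    by (simp only: funpow.simps o_apply Suc x_power_deriv_def pderiv_power_contraction_sum
        monom_mult_contraction_sum)
  moreover have "?X = {1..Suc n} \<times> {1..d}"
    by auto
  ultimately show ?case by (simp add: add.commute)
qed

section \<open>Counting by the number of uncontracted derivatives\<close>

lemma normal_ordering_coeffs_card:
  assumes "d \<le> q"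
  shows "normal_ordering_coeffs q d n (\<lambda>k. int (card
    {g \<in> matchings (to_the_right q) ({1..n} \<times> {1..d}). n * d - card (dom g) = k}))"
    (is "normal_ordering_coeffs q d n ?c")
  unfolding normal_ordering_coeffs_def
proof
  fix p
  let ?X = "{1..n} \<times> {1..d}"
  let ?M = "matchings (to_the_right q) ?X"
  let ?\<kappa> = "\<lambda>g :: nat \<times> nat \<rightharpoonup> nat \<times> nat. n * d - card (dom g)"
  let ?u = "monom 1 ((q - d) * n) :: int poly"
  have finM: "finite ?M"
  proof (rule finite_matchings)
    fix s assume "s \<in> ?X"
    then have "{t. to_the_right q s t} \<subseteq> {1..n} \<times> {1..q}"
      by (auto simp: to_the_right_def)
    then show "finite {t. to_the_right q s t}"
      by (rule finite_subset) simp
  qed simp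
  have le: "card (dom g) \<le> n * d" if "g \<in> ?M" for g
    using that card_mono[of ?X "dom g"] by (simp add: matchings_def)
  have exponent: "n * q - r = (q - d) * n + (n * d - r)" if "r \<le> n * d" for r
  proof -
    have "n * q = (q - d) * n + n * d"
      using assms by (metis add_mult_distrib2 le_add_diff_inverse2 mult.commute)
    then show ?thesis using that by simp
  qed
  have "(x_power_deriv q d ^^ n) p = (\<Sum>g\<in>?M. ?u * x_power_deriv (?\<kappa> g) (?\<kappa> g) p)"
    unfolding x_power_deriv_iterate contraction_sum_def
    by (rule sum.cong) (simp_all add: exponent le x_power_deriv_def mult_monom flip: mult.assoc)
  also have "\<dots> = ?u * (\<Sum>g\<in>?M. x_power_deriv (?\<kappa> g) (?\<kappa> g) p)"
    by (simp add: sum_distrib_left)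
  also have "(\<Sum>g\<in>?M. x_power_deriv (?\<kappa> g) (?\<kappa> g) p) =
      (\<Sum>k\<le>n * d. \<Sum>g\<in>{g \<in> ?M. ?\<kappa> g = k}. x_power_deriv (?\<kappa> g) (?\<kappa> g) p)"
    by (rule sum.group[symmetric]) (use finM in auto)
  also have "\<dots> = (\<Sum>k\<le>n * d. smult (?c k) (x_power_deriv k k p))"
    by (rule sum.cong) (simp_all add: of_nat_poly)
  also have "\<dots> = Sum_any (\<lambda>k. smult (?c k) (x_power_deriv k k p))"
  proof (rule Sum_any.expand_superset[symmetric])
    have "?c k = 0" if "\<not> k \<le> n * d" for k
    proof -
      have "{g \<in> ?M. ?\<kappa> g = k} = {}"
        using that by auto
      then show ?thesis by (simp only: card.empty of_nat_0)
    qed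
    then show "{k. smult (?c k) (x_power_deriv k k p) \<noteq> 0} \<subseteq> {..n * d}"
      by fastforce
  qed simp
  finally show "(x_power_deriv q d ^^ n) p =
      ?u * Sum_any (\<lambda>k. smult (?c k) (x_power_deriv k k p))" .
qed

lemma bij_betw_the_ran_iff:
  "bij_betw (\<lambda>x. the (g x)) (dom g) (ran g) \<longleftrightarrow> inj_on g (dom g)"
proof -
  have "(\<lambda>x. the (g x)) ` dom g = ran g"
    by (force simp: ran_def)
  moreover have "inj_on (\<lambda>x. the (g x)) (dom g) \<longleftrightarrow> inj_on g (dom g)"
    unfolding inj_on_def by (intro ball_cong refl) (auto simp: dom_def)
  ultimately show ?thesis by (simp add: bij_betw_def)
qed

lemma matchings_to_the_right_eq:
  "matchings (to_the_right q) ({1..n} \<times> {1..d}) =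
    {g \<in> partial_bijections ({1..n} \<times> {1..d}) ({1..n} \<times> {1..q}).
      \<forall>i\<in>{1..n}. \<forall>a\<in>{1..d}. \<forall>j\<in>{1..n}. \<forall>b\<in>{1..q}. g (i, a) = Some (j, b) \<longrightarrow> j < i}"
    (is "?M = ?B")
proof (intro equalityI subsetI)
  fix g assume g: "g \<in> ?M"
  then have R: "1 \<le> j \<and> j < i \<and> 1 \<le> b \<and> b \<le> q \<and> i \<le> n" if "g (i, a) = Some (j, b)" for i a j b
    using that by (fastforce simp: matchings_def to_the_right_def)
  then have "ran g \<subseteq> {1..n} \<times> {1..q}"
    by (fastforce simp: ran_def)
  with g have "g \<in> partial_bijections ({1..n} \<times> {1..d}) ({1..n} \<times> {1..q})"
    by (simp add: matchings_def partial_bijections_def bij_betw_the_ran_iff)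
  with R show "g \<in> ?B" by blast
next
  fix g assume g: "g \<in> ?B"
  have "to_the_right q (i, a) (j, b)" if "g (i, a) = Some (j, b)" for i a j b
  proof -
    have *: "(i, a) \<in> {1..n} \<times> {1..d}" "(j, b) \<in> {1..n} \<times> {1..q}"
      using g that by (auto simp: partial_bijections_def intro: ranI)
    then have "j < i"
      using g that by blast
    with * show ?thesis
      by (simp add: to_the_right_def)
  qed
  with g show "g \<in> ?M"
    by (simp add: matchings_def partial_bijections_def bij_betw_the_ran_iff)
qed

theorem corollary6p22:
  fixes n k d q :: nat
  assumes "q \<ge> d"
  shows "gen_stirling q d n k =
    int (card {g \<in> partial_bijections ({1..n} \<times> {1..d}) ({1..n} \<times> {1..q}).
      (\<forall>i\<in>{1..n}. \<forall>a\<in>{1..d}. \<forall>j\<in>{1..n}. \<forall>b\<in>{1..q}.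
          g (i, a) = Some (j, b) \<longrightarrow> j < i) \<and>
      int (card (dom g)) = int (n * d) - int k})"
    (is "_ = int (card {g \<in> ?P. ?back g \<and> ?size g})")
proof -
  let ?M = "matchings (to_the_right q) ({1..n} \<times> {1..d})"
  have "gen_stirling q d n k = int (card {g \<in> ?M. n * d - card (dom g) = k})"
    unfolding gen_stirling_def
    by (subst the_equality[where P = "normal_ordering_coeffs q d n"])
       (rule normal_ordering_coeffs_card[OF assms], erule normal_ordering_coeffs_unique,
        rule normal_ordering_coeffs_card[OF assms], rule refl)
  also have "{g \<in> ?M. n * d - card (dom g) = k} = {g \<in> ?M. ?size g}"
  proof (rule Collect_cong, rule conj_cong[OF refl])
    fix g assume "g \<in> ?M"
    then have "card (dom g) \<le> n * d"
      using card_mono[of "{1..n} \<times> {1..d}" "dom g"] by (simp add: matchings_def)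
    then show "n * d - card (dom g) = k \<longleftrightarrow> ?size g" by linarith
  qed
  also have "\<dots> = {g \<in> ?P. ?back g \<and> ?size g}"
    unfolding matchings_to_the_right_eq by blast
  finally show ?thesis .
qed

end
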